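(* Let $\mathcal H$ be a complex separable Hilbert space, let $A,B$ be positive invertible bounded linear operators on $\mathcal H$, and let $m,m',M,M'$ be positive real numbers satisfying either $0<m'I\le A\le mI<MI\le B\le M'I$ or $0<m'I\le B\le mI<MI\le A\le M'I$. Let $v\in(0,1)$ and put $h=\frac{M}{m}$, $r=\min\{v,1-v\}$, $r_1=\min\{2r,1-2r\}$ and $\hat r_1=\min\{2r_1,1-2r_1\}$. Then $$A\nabla B\ \ge\ 2r(A\nabla B-A\#B)+r_1\bigl(A\nabla B+A\#B-2H_{\frac14}(A,B)\bigr)+\mathrm{K}(\sqrt[4]{h},2)^{\hat r_1}H_v(A,B).$$
   Context: $I$ is the identity operator on $\mathcal H$, and inequalities between self-adjoint operators are in the usual (Loewner) operator order; $mI<MI$ means $m<M$. For positive invertible $A,B$ and $v\in[0,1]$: $A\nabla_v B=(1-v)A+vB$ and $A\#_v B=A^{1/2}(A^{-1/2}BA^{-1/2})^vA^{1/2}$; for $v=\frac12$ one writes $A\nabla B$ and $A\#B$. The Heinz operator mean is $H_v(A,B)=\frac{A\#_vB+A\#_{1-v}B}{2}$. For $t>0$, $\mathrm{K}(t,2)=\frac{(t+1)^2}{4t}$ denotes the Kantorovich constant. *)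

theory Defs
  imports "HOL-Analysis.Analysis" "HOL-Computational_Algebra.Polynomial"
begin

text \<open>
  A complex Hilbert space is presented as an extension of the real Hilbert space it carries
  (real inner product = real part of the complex one), so that the norm and topology of
  \<^class>\<open>real_inner\<close>, and the operator space \<^typ>\<open>'a \<Rightarrow>\<^sub>L 'a\<close> with its operator norm, can be used as
  they are. The inner product is linear in its first argument.
\<close>

class complex_hilbert_space = real_inner + banach +
  fixes scaleC :: "complex \<Rightarrow> 'a \<Rightarrow> 'a"  (infixr "*\<^sub>C" 75)
    and cinner :: "'a \<Rightarrow> 'a \<Rightarrow> complex"
  assumes scaleC_add_right: "a *\<^sub>C (x + y) = a *\<^sub>C x + a *\<^sub>C y"
    and scaleC_add_left: "(a + b) *\<^sub>C x = a *\<^sub>C x + b *\<^sub>C x"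
    and scaleC_scaleC: "a *\<^sub>C (b *\<^sub>C x) = (a * b) *\<^sub>C x"
    and scaleC_of_real: "complex_of_real r *\<^sub>C x = r *\<^sub>R x"
    and cinner_add_left: "cinner (x + y) z = cinner x z + cinner y z"
    and cinner_scaleC_left: "cinner (a *\<^sub>C x) y = a * cinner x y"
    and cinner_commute: "cinner y x = cnj (cinner x y)"
    and inner_eq_Re_cinner: "inner x y = Re (cinner x y)"
begin

lemma cinner_self: "cinner x x = complex_of_real ((norm x)\<^sup>2)"
proof -
  have "Im (cinner x x) = 0"
    using cinner_commute[of x x] by (metis cnj.simps(2) equal_neg_zero)
  then show ?thesis
    by (simp add: complex_eq_iff power2_norm_eq_inner inner_eq_Re_cinner)
qed

lemma norm_scaleC: "norm (a *\<^sub>C x) = cmod a * norm x"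
proof -
  have "cinner (a *\<^sub>C x) (a *\<^sub>C x) = a * cnj a * cinner x x"
    by (metis cinner_commute cinner_scaleC_left complex_cnj_mult mult.assoc)
  then have "complex_of_real ((norm (a *\<^sub>C x))\<^sup>2) = complex_of_real ((cmod a * norm x)\<^sup>2)"
    by (simp add: cinner_self complex_mult_cnj cmod_power2 power_mult_distrib)
  then have "(norm (a *\<^sub>C x))\<^sup>2 = (cmod a * norm x)\<^sup>2"
    by (simp only: of_real_eq_iff)
  then show ?thesis
    by (rule power2_eq_imp_eq) simp_all
qed

end

text \<open>
  Elements of \<^typ>\<open>'a \<Rightarrow>\<^sub>L 'a\<close> are only real linear; the bounded operators on the complex Hilbert
  space are those satisfying the following predicate.
\<close>

definition complex_linear :: "('a::complex_hilbert_space \<Rightarrow>\<^sub>L 'a) \<Rightarrow> bool" where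
  "complex_linear T \<longleftrightarrow> (\<forall>c x. T (c *\<^sub>C x) = c *\<^sub>C T x)"

definition positive_op :: "('a::complex_hilbert_space \<Rightarrow>\<^sub>L 'a) \<Rightarrow> bool" where
  "positive_op T \<longleftrightarrow> complex_linear T \<and> (\<forall>x. cinner (T x) x \<in> \<real>\<^sub>\<ge>\<^sub>0)"

definition invertible_op :: "('a::complex_hilbert_space \<Rightarrow>\<^sub>L 'a) \<Rightarrow> bool" where
  "invertible_op T \<longleftrightarrow> complex_linear T \<and>
     (\<exists>S. complex_linear S \<and> S o\<^sub>L T = id_blinfun \<and> T o\<^sub>L S = id_blinfun)"

definition loewner_le :: "('a::complex_hilbert_space \<Rightarrow>\<^sub>L 'a) \<Rightarrow> ('a \<Rightarrow>\<^sub>L 'a) \<Rightarrow> bool"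
    (infix "\<preceq>" 50) where
  "S \<preceq> T \<longleftrightarrow> positive_op (T - S)"

lift_definition scalar_op :: "complex \<Rightarrow> ('a::complex_hilbert_space \<Rightarrow>\<^sub>L 'a)" is
  "\<lambda>c x. c *\<^sub>C x"
proof (rule bounded_linear_intro)
  fix c :: complex and x y :: 'a and r :: real
  show "c *\<^sub>C (x + y) = c *\<^sub>C x + c *\<^sub>C y" by (rule scaleC_add_right)
  show "c *\<^sub>C (r *\<^sub>R x) = r *\<^sub>R (c *\<^sub>C x)"
    by (metis mult.commute scaleC_of_real scaleC_scaleC)
  show "norm (c *\<^sub>C x) \<le> norm x * cmod c" by (simp add: norm_scaleC)
qed

definition op_spectrum :: "('a::complex_hilbert_space \<Rightarrow>\<^sub>L 'a) \<Rightarrow> complex set" where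
  "op_spectrum T = {c. \<not> invertible_op (T - scalar_op c)}"

definition op_poly :: "real poly \<Rightarrow> ('a::complex_hilbert_space \<Rightarrow>\<^sub>L 'a) \<Rightarrow> ('a \<Rightarrow>\<^sub>L 'a)" where
  "op_poly p T = (\<Sum>i\<le>degree p. coeff p i *\<^sub>R (((\<lambda>S. T o\<^sub>L S) ^^ i) id_blinfun))"

text \<open>
  Continuous functional calculus: \<open>f(T)\<close> is the operator norm limit of \<open>p\<^sub>n(T)\<close> for any real
  polynomials \<open>p\<^sub>n\<close> converging to \<open>f\<close> uniformly on the spectrum. Intended for self-adjoint \<open>T\<close>,
  whose spectrum is real, and for \<open>f\<close> continuous on the spectrum; the limit then exists and does
  not depend on the approximating sequence.
\<close>

definition op_fun :: "(real \<Rightarrow> real) \<Rightarrow> ('a::complex_hilbert_space \<Rightarrow>\<^sub>L 'a) \<Rightarrow> ('a \<Rightarrow>\<^sub>L 'a)" where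
  "op_fun f T = (THE S. \<exists>p :: nat \<Rightarrow> real poly.
     uniform_limit {t. complex_of_real t \<in> op_spectrum T} (\<lambda>n. poly (p n)) f sequentially \<and>
     (\<lambda>n. op_poly (p n) T) \<longlonglongrightarrow> S)"

definition op_powr :: "('a::complex_hilbert_space \<Rightarrow>\<^sub>L 'a) \<Rightarrow> real \<Rightarrow> ('a \<Rightarrow>\<^sub>L 'a)" where
  "op_powr T s = op_fun (\<lambda>t. t powr s) T"

definition arith_mean :: "real \<Rightarrow> ('a::complex_hilbert_space \<Rightarrow>\<^sub>L 'a) \<Rightarrow> ('a \<Rightarrow>\<^sub>L 'a) \<Rightarrow> ('a \<Rightarrow>\<^sub>L 'a)" where
  "arith_mean v A B = (1 - v) *\<^sub>R A + v *\<^sub>R B"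

definition geom_mean :: "real \<Rightarrow> ('a::complex_hilbert_space \<Rightarrow>\<^sub>L 'a) \<Rightarrow> ('a \<Rightarrow>\<^sub>L 'a) \<Rightarrow> ('a \<Rightarrow>\<^sub>L 'a)" where
  "geom_mean v A B =
     op_powr A (1/2) o\<^sub>L op_powr (op_powr A (- 1/2) o\<^sub>L B o\<^sub>L op_powr A (- 1/2)) v o\<^sub>L op_powr A (1/2)"

definition heinz_mean :: "real \<Rightarrow> ('a::complex_hilbert_space \<Rightarrow>\<^sub>L 'a) \<Rightarrow> ('a \<Rightarrow>\<^sub>L 'a) \<Rightarrow> ('a \<Rightarrow>\<^sub>L 'a)" where
  "heinz_mean v A B = (1/2) *\<^sub>R (geom_mean v A B + geom_mean (1 - v) A B)"

text \<open>The Kantorovich constant \<open>K(t,2)\<close>.\<close>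

definition kantorovich :: "real \<Rightarrow> real" where
  "kantorovich t = (t + 1)\<^sup>2 / (4 * t)"

end

theory Submission
  imports Defs "HOL-Computational_Algebra.Fundamental_Theorem_Algebra"
begin

text \<open>
  With \<open>C = A\<^sup>-\<^sup>1\<^sup>/\<^sup>2 B A\<^sup>-\<^sup>1\<^sup>/\<^sup>2\<close>, every mean of \<open>A\<close> and \<open>B\<close> is \<open>A\<^sup>1\<^sup>/\<^sup>2 f(C) A\<^sup>1\<^sup>/\<^sup>2\<close> for a scalar
  function \<open>f\<close>, and the hypotheses put the spectrum of \<open>C\<close> in \<open>t \<ge> h\<close> or in \<open>t \<le> 1/h\<close>. So the claim
  reduces to a scalar inequality in \<open>t\<close>. With \<open>x = t\<^sup>1\<^sup>/\<^sup>4\<close> that one comes from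
  \<open>(1 - w) + w x = (1 - 2 w) + 2 w (1 + x) / 2 \<ge> ((1 + x) / 2)\<^sup>2\<^sup>w = K(x,2)\<^sup>w x\<^sup>w\<close> for \<open>w \<le> 1/2\<close>, after
  subtracting squares and averaging over \<open>v\<close> and \<open>1 - v\<close>.

  The functional calculus rests on one fact: a real polynomial nonnegative on the real spectrum of a
  self-adjoint \<open>T\<close> is nonnegative at \<open>T\<close>. The bottom \<open>l\<close> of the numerical range of \<open>p(T)\<close> is spectral,
  so \<open>p - l\<close> must have a root in the spectrum: a real polynomial is a product of linear factors and of
  factors \<open>(t - a)\<^sup>2 + b\<^sup>2\<close>, and the latter are coercive, hence invertible, at \<open>T\<close>.
\<close>

section \<open>The scalar inequality\<close>

lemma kantorovich_ge_1:
  assumes "0 < x" shows "1 \<le> kantorovich x"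
proof -
  have "4 * x \<le> (x + 1)\<^sup>2"
    using sum_squares_ge_zero[of "x - 1" 0] by (simp add: power2_eq_square algebra_simps)
  then show ?thesis using assms by (simp add: kantorovich_def)
qed

lemma kantorovich_inverse:
  assumes "0 < x" shows "kantorovich (inverse x) = kantorovich x"
  using assms by (simp add: kantorovich_def power2_eq_square field_simps)

lemma kantorovich_mono:
  assumes "1 \<le> x" "x \<le> y" shows "kantorovich x \<le> kantorovich y"
proof -
  \<comment> \<open>Clearing denominators turns the claim into
    \<open>(y + 1)^2 * x - (x + 1)^2 * y \<ge> 0\<close>, and this difference factors as the product
    below.\<close>
  have "0 \<le> (y - x) * (x * y - 1)"
    using assms mult_mono[of 1 x 1 y] by simp
  then have "(x + 1)\<^sup>2 * y \<le> (y + 1)\<^sup>2 * x"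
    by (simp add: power2_eq_square algebra_simps)
  then show ?thesis
    using assms by (simp add: kantorovich_def divide_simps mult.commute)
qed

lemma kantorovich_young_half:
  assumes "0 \<le> w" "w \<le> 1/2" "0 < x"
  shows "kantorovich x powr w * x powr w \<le> (1 - w) + w * x"
proof -
  have "kantorovich x powr w * x powr w = (kantorovich x * x) powr w"
    by (rule powr_mult[symmetric])
  also have "kantorovich x * x = ((x + 1) / 2) powr 2"
    using assms by (simp add: kantorovich_def power2_eq_square field_simps)
  \<comment> \<open>The factor \<open>1 powr (1 - 2 * w)\<close>, equal to 1, displays a weighted
    geometric mean of 1 and \<open>(x + 1) / 2\<close>; the bound \<open>w \<le> 1/2\<close> keeps
    its first weight nonnegative.\<close>
  also have "(((x + 1) / 2) powr 2) powr w = 1 powr (1 - 2 * w) * ((x + 1) / 2) powr (2 * w)"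
    by (simp add: powr_powr)
  also have "\<dots> \<le> (1 - 2 * w) * 1 + 2 * w * ((x + 1) / 2)"
    using assms by (intro Youngs_inequality_0) auto
  finally show ?thesis by (simp add: field_simps)
qed

text \<open>Beyond 1/2 the roles of 1 and x are exchanged: the half-range case is applied to
  \<open>1 - w\<close> and \<open>inverse x\<close>, then multiplied by x. The constant survives
  because it is invariant under inversion.\<close>

lemma kantorovich_young:
  assumes "0 \<le> w" "w \<le> 1" "0 < x"
  shows "kantorovich x powr (min w (1 - w)) * x powr w \<le> (1 - w) + w * x"
proof (cases "w \<le> 1/2")
  case True
  then show ?thesis using kantorovich_young_half[of w x] assms by (simp add: min_def)
next
  case False
  have "kantorovich x powr (1 - w) * inverse x powr (1 - w) \<le> w + (1 - w) * inverse x"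
    using kantorovich_young_half[of "1 - w" "inverse x"] False assms
    by (simp add: kantorovich_inverse)
  then have "(kantorovich x powr (1 - w) * inverse x powr (1 - w)) * x \<le> (w + (1 - w) * inverse x) * x"
    using assms by (intro mult_right_mono) auto
  also have "(w + (1 - w) * inverse x) * x = (1 - w) + w * x"
    using assms by (simp add: field_simps)
  also have "(kantorovich x powr (1 - w) * inverse x powr (1 - w)) * x
      = kantorovich x powr (1 - w) * x powr w"
    using assms by (simp add: inverse_powr powr_minus[symmetric] powr_mult_base mult.assoc mult.commute[of _ x])
  finally show ?thesis using False by (simp add: min_def)
qed

text \<open>Moving the two squares to the right leaves \<open>(1 - 4 * v) + 4 * v * x\<close> when
  \<open>v \<le> 1/4\<close>, and \<open>x * ((2 - 4 * v) + (4 * v - 1) * x)\<close> otherwise.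
  Either way what remains is \<open>kantorovich_young\<close>, with weight \<open>4 * v\<close> or
  \<open>4 * v - 1\<close>, and its exponent is exactly
  \<open>min (2 * r1) (1 - 2 * r1)\<close>.\<close>

lemma kantorovich_young_refined:
  assumes "0 \<le> v" "v \<le> 1/2" "0 < x"
    and r1: "r1 = min (2 * v) (1 - 2 * v)"
  shows "v * (1 - x\<^sup>2)\<^sup>2 + r1 * (1 - x)\<^sup>2
    + kantorovich x powr (min (2 * r1) (1 - 2 * r1)) * x powr (4 * v) \<le> (1 - v) + v * x ^ 4"
proof (cases "v \<le> 1/4")
  case True
  then have "r1 = 2 * v" using r1 by simp
  then show ?thesis
    using kantorovich_young[of "4 * v" x] assms True
    by (simp add: power2_eq_square algebra_simps eval_nat_numeral)
next
  case False
  then have r: "r1 = 1 - 2 * v" using r1 by simp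
  have "kantorovich x powr (min (4 * v - 1) (2 - 4 * v)) * x powr (4 * v - 1)
      \<le> (2 - 4 * v) + (4 * v - 1) * x"
    using kantorovich_young[of "4 * v - 1" x] assms False by simp
  then have "(kantorovich x powr (min (4 * v - 1) (2 - 4 * v)) * x powr (4 * v - 1)) * x
      \<le> ((2 - 4 * v) + (4 * v - 1) * x) * x"
    using assms by (intro mult_right_mono) auto
  also have "x powr (4 * v) = x powr (4 * v - 1) * x"
    using assms by (simp add: powr_diff)
  then have "(kantorovich x powr (min (4 * v - 1) (2 - 4 * v)) * x powr (4 * v - 1)) * x
     = kantorovich x powr (min (2 * r1) (1 - 2 * r1)) * x powr (4 * v)"
    using r by (simp add: min.commute mult_ac)
  finally show ?thesis
    unfolding r by (simp add: power2_eq_square algebra_simps eval_nat_numeral)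
qed

text \<open>This is the average of the refined inequality at x and of the one at
  \<open>inverse x\<close> multiplied by \<open>x ^ 4\<close>, which amounts to exchanging v and
  \<open>1 - v\<close>. The terms with \<open>r1\<close> combine through
  \<open>(1 - x)^2 + (x - x^2)^2 = (1 - x)^2 * (1 + x^2)\<close>.\<close>

lemma heinz_scalar_half:
  assumes v: "0 \<le> v" "v \<le> 1/2" and x: "0 < x"
    and r1: "r1 = min (2 * v) (1 - 2 * v)"
  shows "2 * v * ((1 + x ^ 4) / 2 - x\<^sup>2) + r1 * ((1 + x ^ 4) / 2 + x\<^sup>2 - (x + x ^ 3))
    + kantorovich x powr (min (2 * r1) (1 - 2 * r1)) * ((x powr (4 * v) + x powr (4 * (1 - v))) / 2)
    \<le> (1 + x ^ 4) / 2"
proof -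
  define K where "K = kantorovich x powr (min (2 * r1) (1 - 2 * r1))"
  have 1: "v * (1 - x\<^sup>2)\<^sup>2 + r1 * (1 - x)\<^sup>2 + K * x powr (4 * v) \<le> (1 - v) + v * x ^ 4"
    unfolding K_def by (rule kantorovich_young_refined[OF v x r1])
  have "v * (1 - (inverse x)\<^sup>2)\<^sup>2 + r1 * (1 - inverse x)\<^sup>2 + K * inverse x powr (4 * v)
      \<le> (1 - v) + v * inverse x ^ 4"
    using kantorovich_young_refined[OF v _ r1, of "inverse x"] x by (simp add: K_def kantorovich_inverse)
  then have "(v * (1 - (inverse x)\<^sup>2)\<^sup>2 + r1 * (1 - inverse x)\<^sup>2 + K * inverse x powr (4 * v)) * x ^ 4
      \<le> ((1 - v) + v * inverse x ^ 4) * x ^ 4"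
    using x by (intro mult_right_mono) auto
  also have "((1 - v) + v * inverse x ^ 4) * x ^ 4 = (1 - v) * x ^ 4 + v"
    using x by (simp add: field_simps)
  also have "(v * (1 - (inverse x)\<^sup>2)\<^sup>2 + r1 * (1 - inverse x)\<^sup>2 + K * inverse x powr (4 * v)) * x ^ 4
      = v * (1 - x\<^sup>2)\<^sup>2 + r1 * (x - x\<^sup>2)\<^sup>2 + K * x powr (4 * (1 - v))"
  proof -
    have "(1 - (inverse x)\<^sup>2)\<^sup>2 * x ^ 4 = (1 - x\<^sup>2)\<^sup>2" "(1 - inverse x)\<^sup>2 * x ^ 4 = (x - x\<^sup>2)\<^sup>2"
      using x by (simp_all add: field_simps power2_eq_square eval_nat_numeral)
    moreover have "inverse x powr (4 * v) * x ^ 4 = x powr (4 * (1 - v))"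
      using x powr_realpow[OF x, of 4] powr_add[of x 4 "- (4 * v)"]
      by (simp add: inverse_powr powr_minus[symmetric] algebra_simps)
    ultimately show ?thesis by (simp add: algebra_simps)
  qed
  finally have 2: "v * (1 - x\<^sup>2)\<^sup>2 + r1 * (x - x\<^sup>2)\<^sup>2 + K * x powr (4 * (1 - v)) \<le> (1 - v) * x ^ 4 + v" .
  from 1 2 show ?thesis
    unfolding K_def[symmetric] by (simp add: power2_eq_square algebra_simps eval_nat_numeral add_divide_distrib)
qed

lemma heinz_scalar:
  assumes v: "0 \<le> v" "v \<le> 1" and t: "0 < t" and h: "1 < h" "h \<le> t \<or> h * t \<le> 1"
    and r: "r = min v (1 - v)"
    and r1: "r1 = min (2 * r) (1 - 2 * r)"
    and r1': "r1' = min (2 * r1) (1 - 2 * r1)"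
  shows "2 * r * ((1 + t) / 2 - t powr (1/2))
    + r1 * ((1 + t) / 2 + t powr (1/2) - (t powr (1/4) + t powr (3/4)))
    + kantorovich (root 4 h) powr r1' * ((t powr v + t powr (1 - v)) / 2) \<le> (1 + t) / 2"
proof -
  define x where "x = t powr (1/4)"
  have x: "0 < x" using t by (simp add: x_def)
  have powrs: "x powr (4 * u) = t powr u" for u
    by (simp add: x_def powr_powr)
  have pows: "x ^ 4 = t" "x\<^sup>2 = t powr (1/2)" "x ^ 3 = t powr (3/4)"
    using t by (simp_all add: x_def powr_power)
  have r_range: "0 \<le> r" "r \<le> 1/2" using v r by (auto simp: min_def)
  then have "0 \<le> r1'" using r1 r1' by (auto simp: min_def)
  have root: "root 4 h = h powr (1/4)"
    using h by (simp add: root_powr_inverse)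
  have root1: "1 \<le> root 4 h" using h by simp
  \<comment> \<open>Either x or \<open>inverse x\<close> is at least \<open>root 4 h\<close>, which
    is at least 1, so monotonicity on that range and inversion invariance make h the worst
    case.\<close>
  have "kantorovich (root 4 h) \<le> kantorovich x"
    using h(2)
  proof
    assume "h \<le> t"
    then have "root 4 h \<le> x" using h by (simp add: root x_def powr_mono2)
    then show ?thesis by (rule kantorovich_mono[OF root1])
  next
    assume "h * t \<le> 1"
    then have "h powr (1/4) * x \<le> 1"
      using h t powr_mono2[of "1/4" "h * t" 1] by (simp add: x_def powr_mult)
    then have "root 4 h \<le> inverse x" using x by (simp add: root field_simps)
    from kantorovich_mono[OF root1 this] show ?thesis by (simp add: kantorovich_inverse[OF x])
  qed
  then have K: "kantorovich (root 4 h) powr r1' \<le> kantorovich x powr r1'"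
    using \<open>0 \<le> r1'\<close> kantorovich_ge_1[of "root 4 h"] root1 by (intro powr_mono2) auto
  \<comment> \<open>The Heinz sum is symmetric in v and \<open>1 - v\<close>, so the half-range
    result may be used at r.\<close>
  have "x powr (4 * r) + x powr (4 * (1 - r)) = t powr v + t powr (1 - v)"
    unfolding powrs r by (auto simp: min_def)
  then have "2 * r * ((1 + t) / 2 - t powr (1/2))
    + r1 * ((1 + t) / 2 + t powr (1/2) - (t powr (1/4) + t powr (3/4)))
    + kantorovich x powr r1' * ((t powr v + t powr (1 - v)) / 2) \<le> (1 + t) / 2"
    using heinz_scalar_half[OF r_range x r1] by (simp add: pows r1' x_def[symmetric])
  moreover have "kantorovich (root 4 h) powr r1' * ((t powr v + t powr (1 - v)) / 2)
      \<le> kantorovich x powr r1' * ((t powr v + t powr (1 - v)) / 2)"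
    using K by (intro mult_right_mono) auto
  ultimately show ?thesis by linarith
qed

section \<open>Self-adjoint and invertible operators\<close>

text \<open>For complex linear \<open>T\<close>, symmetry for the real inner product already implies symmetry for \<open>cinner\<close>.\<close>

definition selfadjoint :: "('a::complex_hilbert_space \<Rightarrow>\<^sub>L 'a) \<Rightarrow> bool" where
  "selfadjoint T \<longleftrightarrow> complex_linear T \<and> (\<forall>x y. inner (T x) y = inner x (T y))"

lemma selfadjointD:
  "selfadjoint T \<Longrightarrow> complex_linear T"
  "selfadjoint T \<Longrightarrow> inner (T x) y = inner x (T y)"
  by (simp_all add: selfadjoint_def)

section \<open>Complex scalars seen through the real inner product\<close>

lemma scaleC_scaleR_commute: "c *\<^sub>C (s *\<^sub>R x) = s *\<^sub>R (c *\<^sub>C (x::'a::complex_hilbert_space))"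
  by (metis mult.commute scaleC_of_real scaleC_scaleC)

lemma scaleC_diff_right: "c *\<^sub>C (x - y) = c *\<^sub>C x - c *\<^sub>C (y::'a::complex_hilbert_space)"
  using scaleC_add_right[of c "x - y" y] by (simp add: algebra_simps)

lemma scaleC_zero_right: "c *\<^sub>C (0::'a::complex_hilbert_space) = 0"
  using scaleC_diff_right[of c "0::'a" 0] by simp

lemma tendsto_scaleC:
  fixes f :: "'b \<Rightarrow> 'a::complex_hilbert_space"
  assumes "(f \<longlongrightarrow> l) F"
  shows "((\<lambda>x. c *\<^sub>C f x) \<longlongrightarrow> c *\<^sub>C l) F"
  using blinfun.tendsto[OF tendsto_const[of "scalar_op c"] assms] by (simp add: scalar_op.rep_eq)

lemma cinner_iscaleC_left_Re:
  "inner (\<i> *\<^sub>C x) (y::'a::complex_hilbert_space) = - Im (cinner x y)"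
  by (simp add: inner_eq_Re_cinner cinner_scaleC_left)

lemma cinner_iscaleC_right_Re:
  "inner x (\<i> *\<^sub>C (y::'a::complex_hilbert_space)) = Im (cinner x y)"
  by (metis cinner_commute cinner_iscaleC_left_Re complex_cnj inner_commute complex.sel(2) minus_minus complex_surj)

lemma complex_linear_intros:
  "complex_linear S \<Longrightarrow> complex_linear T \<Longrightarrow> complex_linear (S + T)"
  "complex_linear S \<Longrightarrow> complex_linear T \<Longrightarrow> complex_linear (S - T)"
  "complex_linear S \<Longrightarrow> complex_linear T \<Longrightarrow> complex_linear (S o\<^sub>L T)"
  "complex_linear S \<Longrightarrow> complex_linear (a *\<^sub>R S)"
  "complex_linear 0"
  "complex_linear id_blinfun"
  by (simp_all add: complex_linear_def plus_blinfun.rep_eq minus_blinfun.rep_eq scaleR_blinfun.rep_eq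
      scaleC_add_right scaleC_diff_right scaleC_scaleR_commute scaleC_zero_right)

lemma selfadjoint_intros:
  "selfadjoint S \<Longrightarrow> selfadjoint T \<Longrightarrow> selfadjoint (S + T)"
  "selfadjoint S \<Longrightarrow> selfadjoint T \<Longrightarrow> selfadjoint (S - T)"
  "selfadjoint S \<Longrightarrow> selfadjoint (a *\<^sub>R S)"
  "selfadjoint 0"
  "selfadjoint id_blinfun"
  by (auto simp: selfadjoint_def intro!: complex_linear_intros)
    (auto simp: plus_blinfun.rep_eq minus_blinfun.rep_eq scaleR_blinfun.rep_eq inner_simps)

lemma selfadjoint_compose_compose:
  assumes "selfadjoint S" "selfadjoint T"
  shows "selfadjoint (S o\<^sub>L T o\<^sub>L S)"
  using assms by (auto simp: selfadjoint_def intro!: complex_linear_intros)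

lemma selfadjoint_compose_commute:
  assumes "selfadjoint S" "selfadjoint T" "S o\<^sub>L T = T o\<^sub>L S"
  shows "selfadjoint (S o\<^sub>L T)"
proof -
  have "S (T x) = T (S x)" for x
    using assms(3) by (metis blinfun_apply_blinfun_compose)
  then show ?thesis
    using assms(1,2) by (auto simp: selfadjoint_def intro!: complex_linear_intros)
qed

text \<open>Transfers positivity to the real inner product, where the later estimates take
  place.\<close>

lemma positive_op_iff:
  "positive_op T \<longleftrightarrow> selfadjoint T \<and> (\<forall>x. 0 \<le> inner (T x) x)"
proof
  assume T: "positive_op T"
  then have cl: "complex_linear T" and pos: "cinner (T x) x \<in> \<real>\<^sub>\<ge>\<^sub>0" for x
    by (auto simp: positive_op_def)
  have im: "Im (cinner (T x) x) = 0" and re: "0 \<le> inner (T x) x" for x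
    using pos[of x] by (auto simp: complex_nonneg_Reals_iff inner_eq_Re_cinner)
  have "inner (T x) y = inner x (T y)" for x y
  proof -
    \<comment> \<open>Polarisation: the imaginary part of \<open>cinner (T z) z\<close> vanishes at
      \<open>x + \<i> *\<^sub>C y\<close>, at x and at \<open>\<i> *\<^sub>C y\<close>. Expanding
      the first leaves only the cross terms, which say
      \<open>inner (T x) y = inner (T y) x\<close>.\<close>
    have "inner (T (x + \<i> *\<^sub>C y)) (\<i> *\<^sub>C (x + \<i> *\<^sub>C y)) = 0"
         "inner (T x) (\<i> *\<^sub>C x) = 0" "inner (T (\<i> *\<^sub>C y)) (\<i> *\<^sub>C (\<i> *\<^sub>C y)) = 0"
      by (simp_all only: cinner_iscaleC_right_Re im)
    moreover have "\<i> *\<^sub>C (\<i> *\<^sub>C z) = - z" for z :: 'a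
      using scaleC_of_real[of "-1" z] by (simp add: scaleC_scaleC)
    moreover have "inner (\<i> *\<^sub>C u) (\<i> *\<^sub>C w) = inner u w" for u w :: 'a
      unfolding cinner_iscaleC_right_Re by (simp add: cinner_scaleC_left inner_eq_Re_cinner)
    ultimately show ?thesis
      using cl by (simp add: complex_linear_def blinfun.add_right scaleC_add_right inner_simps inner_commute)
  qed
  then show "selfadjoint T \<and> (\<forall>x. 0 \<le> inner (T x) x)"
    using cl re by (auto simp: selfadjoint_def)
next
  assume T: "selfadjoint T \<and> (\<forall>x. 0 \<le> inner (T x) x)"
  then have cl: "complex_linear T" and sym: "inner (T x) y = inner x (T y)" for x y
    by (auto simp: selfadjoint_def)
  have "Im (cinner (T x) x) = 0" for x
    using sym[of x "\<i> *\<^sub>C x"] cl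
    by (simp add: complex_linear_def cinner_iscaleC_right_Re cinner_iscaleC_left_Re inner_commute[of x])
  then show "positive_op T"
    using T cl by (auto simp: positive_op_def complex_nonneg_Reals_iff inner_eq_Re_cinner)
qed

lemma loewner_le_iff:
  assumes "selfadjoint S" "selfadjoint T"
  shows "S \<preceq> T \<longleftrightarrow> (\<forall>x. inner (S x) x \<le> inner (T x) x)"
  using selfadjoint_intros(2)[OF assms(2,1)]
  by (simp add: loewner_le_def positive_op_iff minus_blinfun.rep_eq inner_simps)

text \<open>The lower bound gives injectivity and bounds the inverse by
  \<open>inverse \<delta>\<close>. Linearity of the inverse, real and complex, is checked after
  applying the injective T.\<close>

lemma invertible_opI:
  fixes T :: "'a::complex_hilbert_space \<Rightarrow>\<^sub>L 'a"
  assumes cl: "complex_linear T" and \<delta>: "0 < \<delta>"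
    and bound: "\<And>x. \<delta> * norm x \<le> norm (T x)" and surj: "\<And>y. \<exists>x. T x = y"
  shows "invertible_op T"
proof -
  have inj: "x = y" if "T x = T y" for x y
  proof -
    have "\<delta> * norm (x - y) \<le> 0"
      using bound[of "x - y"] that by (simp add: blinfun.diff_right)
    then show ?thesis using \<delta> by (simp add: mult_le_0_iff)
  qed
  define S where "S y = (SOME x. T x = y)" for y
  have TS: "T (S y) = y" for y
    unfolding S_def by (rule someI_ex) (rule surj)
  have bl: "bounded_linear S"
  proof (rule bounded_linear_intro)
    show "S (x + y) = S x + S y" for x y by (rule inj) (simp add: TS blinfun.add_right)
    show "S (a *\<^sub>R x) = a *\<^sub>R S x" for a x by (rule inj) (simp add: TS blinfun.scaleR_right)
    show "norm (S x) \<le> norm x * inverse \<delta>" for x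
      using bound[of "S x"] \<delta> by (simp add: TS field_simps)
  qed
  have "S (c *\<^sub>C x) = c *\<^sub>C S x" for c x
    by (rule inj) (use cl in \<open>simp add: TS complex_linear_def\<close>)
  then have "complex_linear (Blinfun S)"
    by (simp add: complex_linear_def bounded_linear_Blinfun_apply[OF bl])
  moreover have "S (T x) = x" for x
    by (rule inj) (simp add: TS)
  then have "Blinfun S o\<^sub>L T = id_blinfun" "T o\<^sub>L Blinfun S = id_blinfun"
    by (auto intro!: blinfun_eqI simp: bounded_linear_Blinfun_apply[OF bl] TS)
  ultimately show ?thesis
    using cl unfolding invertible_op_def by blast
qed

text \<open>The Lax-Milgram argument: coercivity and Cauchy-Schwarz bound T below, and a Banach
  fixed point solves \<open>T x = y\<close>. Symmetry of T is not assumed.\<close>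

lemma coercive_invertible_op:
  fixes T :: "'a::complex_hilbert_space \<Rightarrow>\<^sub>L 'a"
  assumes cl: "complex_linear T" and \<delta>: "0 < \<delta>"
    and coercive: "\<And>x. \<delta> * (norm x)\<^sup>2 \<le> inner (T x) x"
  shows "invertible_op T"
proof (rule invertible_opI[OF cl \<delta>])
  show "\<delta> * norm x \<le> norm (T x)" for x
  proof (cases "x = 0")
    case False
    have "\<delta> * norm x * norm x \<le> norm (T x) * norm x"
      using coercive[of x] norm_cauchy_schwarz[of "T x" x] by (simp add: power2_eq_square mult.assoc)
    then show ?thesis using False by simp
  qed simp
  \<comment> \<open>K bounds the norm of T and dominates \<open>\<delta>\<close>, so q below is
    nonnegative. The step s minimises \<open>1 - 2 * s * \<delta> + s^2 * K^2\<close>, which bounds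
    the squared contraction factor; the minimum is q.\<close>
  define K where "K = norm T + \<delta>"
  define s where "s = \<delta> / K\<^sup>2"
  have K: "0 < K" "\<delta> \<le> K" using \<delta> by (auto simp: K_def add_nonneg_pos)
  have s: "0 < s" using \<delta> K by (simp add: s_def)
  \<comment> \<open>For this step size the Richardson iteration \<open>x \<mapsto> x - s (T x - y)\<close> contracts.\<close>
  define q where "q = 1 - (\<delta> / K)\<^sup>2"
  have q: "0 \<le> q" "q < 1" using \<delta> K by (auto simp: q_def power_le_one)
  have contr: "norm (x - s *\<^sub>R T x) \<le> sqrt q * norm x" for x
  proof (rule power2_le_imp_le)
    have "norm (T x) \<le> K * norm x"
      using norm_blinfun[of T x] \<delta> by (simp add: K_def distrib_right add_increasing2)
    then have "(norm (T x))\<^sup>2 \<le> K\<^sup>2 * (norm x)\<^sup>2"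
      by (metis norm_ge_zero power_mono power_mult_distrib)
    then have "s\<^sup>2 * (norm (T x))\<^sup>2 \<le> s\<^sup>2 * (K\<^sup>2 * (norm x)\<^sup>2)"
      by (intro mult_left_mono) auto
    moreover have "2 * s * (\<delta> * (norm x)\<^sup>2) \<le> 2 * s * inner (T x) x"
      using coercive[of x] s by (intro mult_left_mono) auto
    moreover have "(norm (x - s *\<^sub>R T x))\<^sup>2 = (norm x)\<^sup>2 - 2 * s * inner (T x) x + s\<^sup>2 * (norm (T x))\<^sup>2"
      unfolding power2_norm_eq_inner by (simp add: inner_simps inner_commute algebra_simps power2_eq_square)
    moreover have "s\<^sup>2 * (K\<^sup>2 * (norm x)\<^sup>2) = (\<delta> / K)\<^sup>2 * (norm x)\<^sup>2"
        "2 * s * (\<delta> * (norm x)\<^sup>2) = 2 * ((\<delta> / K)\<^sup>2 * (norm x)\<^sup>2)"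
      using K by (simp_all add: s_def power_divide field_simps power2_eq_square)
    ultimately show "(norm (x - s *\<^sub>R T x))\<^sup>2 \<le> (sqrt q * norm x)\<^sup>2"
      using q by (simp add: power_mult_distrib) (simp add: q_def algebra_simps)
  qed (use q in auto)
  show "\<exists>x. T x = y" for y
  proof -
    have "\<exists>!x. x - s *\<^sub>R (T x - y) = x"
    proof (rule banach_fix_type)
      show "0 \<le> sqrt q" "sqrt q < 1" using q by auto
      show "\<forall>u w. dist (u - s *\<^sub>R (T u - y)) (w - s *\<^sub>R (T w - y)) \<le> sqrt q * dist u w"
      proof (intro allI)
        fix u w
        have "u - s *\<^sub>R (T u - y) - (w - s *\<^sub>R (T w - y)) = (u - w) - s *\<^sub>R T (u - w)"
          by (simp add: blinfun.diff_right algebra_simps)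
        from contr[of "u - w", folded this]
        show "dist (u - s *\<^sub>R (T u - y)) (w - s *\<^sub>R (T w - y)) \<le> sqrt q * dist u w"
          by (simp only: dist_norm)
      qed
    qed
    then show ?thesis using s by auto
  qed
qed

lemma invertible_op_lower_bound:
  assumes "invertible_op T"
  obtains \<delta> where "0 < \<delta>" "\<And>x. \<delta> * norm x \<le> norm (T x)"
proof -
  obtain S where S: "S o\<^sub>L T = id_blinfun" using assms by (auto simp: invertible_op_def)
  \<comment> \<open>Adding 1 keeps the constant positive on the trivial space, where S is
    zero.\<close>
  have "norm x \<le> (norm S + 1) * norm (T x)" for x
  proof -
    have "x = S (T x)" using S by (metis blinfun_apply_blinfun_compose blinfun_apply_id_blinfun id_apply)
    then have "norm x \<le> norm S * norm (T x)" by (metis norm_blinfun)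
    then show ?thesis by (simp add: distrib_right add_increasing2)
  qed
  moreover have "0 < norm S + 1" by (simp add: add_nonneg_pos)
  ultimately have "inverse (norm S + 1) * norm x \<le> norm (T x)" for x
    by (simp add: inverse_eq_divide pos_divide_le_eq mult.commute)
  with \<open>0 < norm S + 1\<close> show ?thesis using that[of "inverse (norm S + 1)"] by simp
qed

lemma invertible_op_compose:
  assumes "invertible_op S" "invertible_op T"
  shows "invertible_op (S o\<^sub>L T)"
proof -
  obtain S' T' where cl: "complex_linear S'" "complex_linear T'"
    and inv: "S' o\<^sub>L S = id_blinfun" "S o\<^sub>L S' = id_blinfun" "T' o\<^sub>L T = id_blinfun" "T o\<^sub>L T' = id_blinfun"
    using assms by (auto simp: invertible_op_def)
  have "S' (S x) = x" "S (S' x) = x" "T' (T x) = x" "T (T' x) = x" for x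
    using inv by (metis blinfun_apply_blinfun_compose blinfun_apply_id_blinfun id_apply)+
  then have "(T' o\<^sub>L S') o\<^sub>L (S o\<^sub>L T) = id_blinfun" "(S o\<^sub>L T) o\<^sub>L (T' o\<^sub>L S') = id_blinfun"
    by (auto intro!: blinfun_eqI)
  moreover have "complex_linear (T' o\<^sub>L S')" "complex_linear (S o\<^sub>L T)"
    using cl assms by (auto simp: invertible_op_def intro: complex_linear_intros)
  ultimately show ?thesis unfolding invertible_op_def by blast
qed

text \<open>With \<open>s = 1 / (norm T + 1)\<close>, positivity of \<open>T\<close> at \<open>x - s T x\<close> gives
  \<open>s (norm (T x))\<^sup>2 \<le> \<langle>T x, x\<rangle>\<close>.\<close>

lemma positive_invertible_coercive:
  assumes pos: "positive_op T" and inv: "invertible_op T"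
  obtains \<delta> where "0 < \<delta>" "\<And>x. \<delta> * (norm x)\<^sup>2 \<le> inner (T x) x"
proof -
  obtain \<epsilon> where \<epsilon>: "0 < \<epsilon>" "\<And>x. \<epsilon> * norm x \<le> norm (T x)"
    using invertible_op_lower_bound[OF inv] by blast
  define s where "s = inverse (norm T + 1)"
  have s: "0 < s" "s * norm T \<le> 1" 
    using add_nonneg_pos[of "norm T" 1] by (auto simp: s_def field_simps)
  have sym: "inner (T x) y = inner x (T y)" and nonneg: "0 \<le> inner (T x) x" for x y
    using pos by (auto simp: positive_op_iff selfadjoint_def)
  have "s * \<epsilon>\<^sup>2 * (norm x)\<^sup>2 \<le> inner (T x) x" for x
  proof -
    define N where "N = (norm (T x))\<^sup>2"
    have "0 \<le> inner (T (x - s *\<^sub>R T x)) (x - s *\<^sub>R T x)" by (rule nonneg)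
    also have "\<dots> = inner (T x) x - 2 * s * N + s\<^sup>2 * inner (T (T x)) (T x)"
      using sym[of "T x" x]
      unfolding N_def power2_norm_eq_inner
      by (simp add: inner_simps blinfun.diff_right blinfun.scaleR_right algebra_simps power2_eq_square)
    also have "inner (T (T x)) (T x) \<le> norm T * N"
      using norm_cauchy_schwarz[of "T (T x)" "T x"] mult_right_mono[OF norm_blinfun[of T "T x"], of "norm (T x)"]
      by (simp add: N_def power2_eq_square mult.assoc)
    then have "s\<^sup>2 * inner (T (T x)) (T x) \<le> s\<^sup>2 * (norm T * N)"
      by (intro mult_left_mono) auto
    also have "s\<^sup>2 * (norm T * N) = (s * norm T) * (s * N)"
      by (simp add: power2_eq_square)
    also have "\<dots> \<le> 1 * (s * N)"
      using s by (intro mult_right_mono) (auto simp: N_def)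
    finally have "s * N \<le> inner (T x) x" by (simp add: mult.commute)
    moreover have "\<epsilon>\<^sup>2 * (norm x)\<^sup>2 \<le> N"
      using \<epsilon> power_mono[OF \<epsilon>(2)[of x], of 2] by (simp add: N_def power_mult_distrib)
    then have "s * (\<epsilon>\<^sup>2 * (norm x)\<^sup>2) \<le> s * N" using s by (intro mult_left_mono) auto
    ultimately show ?thesis by (simp add: mult.assoc)
  qed
  then show ?thesis using that[of "s * \<epsilon>\<^sup>2"] s \<epsilon> by simp
qed

section \<open>The real spectrum\<close>

lemma invertible_op_scaleR:
  assumes "invertible_op T" "c \<noteq> 0"
  shows "invertible_op (c *\<^sub>R T)"
proof -
  obtain S where cl: "complex_linear S" and inv: "S o\<^sub>L T = id_blinfun" "T o\<^sub>L S = id_blinfun"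
    using assms by (auto simp: invertible_op_def)
  have "S (T x) = x" "T (S x) = x" for x
    using inv by (metis blinfun_apply_blinfun_compose blinfun_apply_id_blinfun id_apply)+
  then have "(inverse c *\<^sub>R S) o\<^sub>L (c *\<^sub>R T) = id_blinfun" "(c *\<^sub>R T) o\<^sub>L (inverse c *\<^sub>R S) = id_blinfun"
    using assms by (auto intro!: blinfun_eqI simp: blinfun.scaleR_left blinfun.scaleR_right)
  moreover have "complex_linear (inverse c *\<^sub>R S)" "complex_linear (c *\<^sub>R T)"
    using cl assms by (auto simp: invertible_op_def intro: complex_linear_intros)
  ultimately show ?thesis unfolding invertible_op_def by blast
qed

lemma invertible_op_id: "invertible_op id_blinfun"
  unfolding invertible_op_def by (auto intro!: complex_linear_intros exI[of _ id_blinfun] blinfun_eqI)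

definition real_spectrum :: "('a::complex_hilbert_space \<Rightarrow>\<^sub>L 'a) \<Rightarrow> real set" where
  "real_spectrum T = {t. complex_of_real t \<in> op_spectrum T}"

lemma real_spectrum_iff: "t \<in> real_spectrum T \<longleftrightarrow> \<not> invertible_op (T - t *\<^sub>R id_blinfun)"
proof -
  have "scalar_op (complex_of_real t) = t *\<^sub>R (id_blinfun :: 'a \<Rightarrow>\<^sub>L 'a)"
    by (rule blinfun_eqI) (simp add: scalar_op.rep_eq scaleC_of_real scaleR_blinfun.rep_eq)
  then show ?thesis by (simp add: real_spectrum_def op_spectrum_def)
qed

text \<open>For \<open>t < a\<close> the operator T - t is coercive with constant
  \<open>a - t\<close>, hence invertible.\<close>

lemma real_spectrum_lower:
  assumes "complex_linear T" "\<And>x. a * (norm x)\<^sup>2 \<le> inner (T x) x" "t \<in> real_spectrum T"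
  shows "a \<le> t"
proof (rule ccontr)
  assume "\<not> a \<le> t"
  then have "invertible_op (T - t *\<^sub>R id_blinfun)"
    using assms(1,2)
    by (intro coercive_invertible_op[of _ "a - t"] complex_linear_intros)
      (simp_all add: blinfun.diff_left blinfun.scaleR_left inner_simps power2_norm_eq_inner algebra_simps)
  then show False using assms(3) by (simp add: real_spectrum_iff)
qed

lemma real_spectrum_upper:
  assumes "complex_linear T" "\<And>x. inner (T x) x \<le> b * (norm x)\<^sup>2" "t \<in> real_spectrum T"
  shows "t \<le> b"
proof (rule ccontr)
  assume "\<not> t \<le> b"
  then have "invertible_op (t *\<^sub>R id_blinfun - T)"
    using assms(1,2)
    by (intro coercive_invertible_op[of _ "t - b"] complex_linear_intros)
      (simp_all add: blinfun.diff_left blinfun.scaleR_left inner_simps power2_norm_eq_inner algebra_simps)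
  from invertible_op_scaleR[OF this, of "-1"] show False
    using assms(3) by (simp add: real_spectrum_iff)
qed

lemma abs_inner_blinfun_le:
  fixes T :: "'a::real_inner \<Rightarrow>\<^sub>L 'a"
  shows "\<bar>inner (T x) x\<bar> \<le> norm T * (norm x)\<^sup>2"
  using Cauchy_Schwarz_ineq2[of "T x" x] mult_right_mono[OF norm_blinfun[of T x], of "norm x"]
  by (simp add: power2_eq_square mult.assoc)

lemma real_spectrum_bounded:
  assumes "complex_linear T"
  shows "real_spectrum T \<subseteq> {- norm T..norm T}"
proof
  fix t assume t: "t \<in> real_spectrum T"
  have "- norm T * (norm x)\<^sup>2 \<le> inner (T x) x" "inner (T x) x \<le> norm T * (norm x)\<^sup>2" for x
    using abs_inner_blinfun_le[of T x] by simp_all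
  then show "t \<in> {- norm T..norm T}"
    using real_spectrum_lower[OF assms _ t] real_spectrum_upper[OF assms _ t] by auto
qed

text \<open>The supremum of the lower bounds of the quadratic form is itself a lower bound. If S
  minus it were invertible, positivity would make it coercive, and the bound could be raised. The
  nonzero vector makes the set of lower bounds bounded above.\<close>

lemma numerical_range_bottom:
  fixes S :: "'a::complex_hilbert_space \<Rightarrow>\<^sub>L 'a"
  assumes S: "selfadjoint S" and x0: "x0 \<noteq> (0::'a)"
  obtains l where "l \<in> real_spectrum S" "\<And>x. l * (norm x)\<^sup>2 \<le> inner (S x) x"
proof -
  define L where "L = {l. \<forall>x. l * (norm x)\<^sup>2 \<le> inner (S x) x}"
  have ne: "- norm S \<in> L"
    using abs_inner_blinfun_le[of S] by (auto simp: L_def abs_le_iff minus_le_iff)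
  have bdd: "bdd_above L"
  proof (rule bdd_aboveI)
    show "l \<le> inner (S x0) x0 / (norm x0)\<^sup>2" if "l \<in> L" for l
      using that x0 by (simp add: L_def pos_le_divide_eq)
  qed
  have low: "Sup L * (norm x)\<^sup>2 \<le> inner (S x) x" for x
  proof (cases "x = 0")
    case False
    then have "Sup L \<le> inner (S x) x / (norm x)\<^sup>2"
      using ne by (intro cSup_least[of L]) (blast, simp add: L_def pos_le_divide_eq)
    then show ?thesis using False by (simp add: pos_le_divide_eq)
  qed simp
  have sa: "selfadjoint (S - Sup L *\<^sub>R id_blinfun)"
    using S by (intro selfadjoint_intros)
  have "positive_op (S - Sup L *\<^sub>R id_blinfun)"
    using low sa by (simp add: positive_op_iff blinfun.diff_left blinfun.scaleR_left inner_simps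
        power2_norm_eq_inner)
  moreover have "\<not> invertible_op (S - Sup L *\<^sub>R id_blinfun)"
  proof
    assume "invertible_op (S - Sup L *\<^sub>R id_blinfun)"
    with calculation obtain \<delta> where \<delta>: "0 < \<delta>"
      "\<And>x. \<delta> * (norm x)\<^sup>2 \<le> inner ((S - Sup L *\<^sub>R id_blinfun) x) x"
      by (rule positive_invertible_coercive) blast
    then have "Sup L + \<delta> \<in> L"
      by (simp add: L_def blinfun.diff_left blinfun.scaleR_left inner_simps power2_norm_eq_inner algebra_simps)
    then show False using cSup_upper[OF _ bdd] \<delta>(1) by fastforce
  qed
  ultimately show ?thesis using that[of "Sup L"] low by (simp add: real_spectrum_iff)
qed

section \<open>Polynomials in a self-adjoint operator\<close>

lemma op_poly_eq_sum:
  assumes "degree p \<le> n"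
  shows "op_poly p T = (\<Sum>i\<le>n. coeff p i *\<^sub>R (((\<lambda>S. T o\<^sub>L S) ^^ i) id_blinfun))"
  unfolding op_poly_def using assms
  by (intro sum.mono_neutral_left) (auto simp: coeff_eq_0)

lemma op_poly_0: "op_poly 0 T = 0"
  by (simp add: op_poly_def)

lemma op_poly_pCons: "op_poly (pCons a p) T = a *\<^sub>R id_blinfun + (T o\<^sub>L op_poly p T)"
proof -
  have "op_poly (pCons a p) T =
      (\<Sum>i\<le>Suc (degree p). coeff (pCons a p) i *\<^sub>R (((\<lambda>S. T o\<^sub>L S) ^^ i) id_blinfun))"
    by (rule op_poly_eq_sum) (rule degree_pCons_le)
  also have "\<dots> = a *\<^sub>R id_blinfun +
      (\<Sum>i\<le>degree p. T o\<^sub>L (coeff p i *\<^sub>R (((\<lambda>S. T o\<^sub>L S) ^^ i) id_blinfun)))"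
    by (simp add: sum.atMost_Suc_shift bounded_bilinear.scaleR_right[OF bounded_bilinear_blinfun_compose]
        del: sum.atMost_Suc)
  finally show ?thesis
    by (simp add: op_poly_def bounded_bilinear.sum_right[OF bounded_bilinear_blinfun_compose])
qed

lemma op_poly_add: "op_poly (p + q) T = op_poly p T + op_poly q T"
  using op_poly_eq_sum[of p "max (degree p) (degree q)" T] op_poly_eq_sum[of q "max (degree p) (degree q)" T]
    op_poly_eq_sum[OF degree_add_le_max, of p q T]
  by (simp add: scaleR_add_left sum.distrib)

lemma op_poly_smult: "op_poly (smult c p) T = c *\<^sub>R op_poly p T"
  using op_poly_eq_sum[OF degree_smult_le, of c p T]
  by (simp add: op_poly_def scaleR_right.sum)

lemma op_poly_diff: "op_poly (p - q) T = op_poly p T - op_poly q T"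
  using op_poly_add[of p "smult (-1) q" T] unfolding op_poly_smult by simp

lemma op_poly_mult: "op_poly (p * q) T = op_poly p T o\<^sub>L op_poly q T"
proof (induction p)
  case (pCons a p)
  then show ?case
    by (auto intro!: blinfun_eqI simp: op_poly_add op_poly_smult op_poly_pCons blinfun.add_left blinfun.scaleR_left)
qed (simp add: op_poly_0)

lemma op_poly_compose_commute: "T o\<^sub>L op_poly p T = op_poly p T o\<^sub>L T"
proof -
  have "op_poly [:0, 1:] T = T"
    by (auto intro!: blinfun_eqI simp: op_poly_pCons op_poly_0 blinfun.add_left)
  then show ?thesis by (metis mult.commute op_poly_mult)
qed

lemma selfadjoint_op_poly:
  assumes "selfadjoint T"
  shows "selfadjoint (op_poly p T)"
  by (induction p) (auto simp: op_poly_0 op_poly_pCons assms op_poly_compose_commute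
      intro!: selfadjoint_intros selfadjoint_compose_commute)

section \<open>Real polynomials at complex points\<close>

lemma poly_map_poly_of_real_add:
  "poly (map_poly complex_of_real (p + q)) z = poly (map_poly of_real p) z + poly (map_poly of_real q) z"
proof (induction p arbitrary: q)
  case (pCons a p)
  then show ?case by (cases q) (simp add: map_poly_pCons algebra_simps)
qed simp

lemma poly_map_poly_of_real_mult:
  "poly (map_poly complex_of_real (p * q)) z = poly (map_poly of_real p) z * poly (map_poly of_real q) z"
  by (induction p) (simp_all add: map_poly_pCons poly_map_poly_of_real_add map_poly_smult algebra_simps)

lemma poly_map_poly_of_real_of_real:
  "poly (map_poly complex_of_real p) (of_real t) = of_real (poly p t)"
  by (induction p) (simp_all add: map_poly_pCons)

lemma real_poly_factor:
  fixes q :: "real poly"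
  assumes "degree q \<noteq> 0"
  obtains t where "[:- t, 1:] dvd q" | a b where "b \<noteq> 0" "[:a\<^sup>2 + b\<^sup>2, - 2 * a, 1:] dvd q"
proof -
  have "\<not> constant (poly (map_poly complex_of_real q))"
    using assms by (simp add: constant_degree degree_map_poly)
  then obtain z where z: "poly (map_poly complex_of_real q) z = 0"
    using fundamental_theorem_of_algebra by blast
  show ?thesis
  proof (cases "Im z = 0")
    case True
    then have "z = of_real (Re z)" by (simp add: complex_eq_iff)
    then have "complex_of_real (poly q (Re z)) = 0"
      using z by (metis of_real_0 poly_map_poly_of_real_of_real of_real_eq_0_iff)
    then show ?thesis using that(1) by (simp add: poly_eq_0_iff_dvd)
  next
    case False
    \<comment> \<open>The monic real quadratic whose roots are z and its conjugate.\<close>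
    define d where "d = [:(Re z)\<^sup>2 + (Im z)\<^sup>2, - 2 * Re z, 1:]"
    have "poly (map_poly complex_of_real d) z = 0"
      by (simp add: d_def map_poly_pCons complex_eq_iff power2_eq_square algebra_simps)
    moreover have "q = d * (q div d) + q mod d" by simp
    ultimately have rem: "poly (map_poly complex_of_real (q mod d)) z = 0"
      using z by (metis add_0 mult_zero_left poly_map_poly_of_real_add poly_map_poly_of_real_mult)
    have "degree (q mod d) < 2 \<or> q mod d = 0"
      using degree_mod_less[of d q] by (auto simp: d_def)
    then have "degree (q mod d) \<le> 1" by auto
    then obtain \<alpha> \<beta> where mod: "q mod d = [:\<alpha>, \<beta>:]"
      by (metis degree1_coeffs degree_0_id le_numeral_extra(3) linorder_not_le less_one nat_less_le pCons_0_0 )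
    \<comment> \<open>A real polynomial of degree at most 1 that vanishes at a nonreal point is
      zero.\<close>
    from rem have "\<beta> * Im z = 0" "\<alpha> + \<beta> * Re z = 0"
      by (simp_all add: mod map_poly_pCons complex_eq_iff mult.commute)
    then have "q mod d = 0" using False by (simp add: mod)
    then show ?thesis using that(2) False by (auto simp: d_def mod_eq_0_iff_dvd)
  qed
qed

lemma op_poly_invertible:
  assumes T: "selfadjoint T" and "q \<noteq> 0" and "\<And>t. t \<in> real_spectrum T \<Longrightarrow> poly q t \<noteq> 0"
  shows "invertible_op (op_poly q T)"
  using assms(2,3)
proof (induction "degree q" arbitrary: q rule: less_induct)
  case less
  \<comment> \<open>Splitting off a nonconstant divisor leaves a cofactor of smaller degree, whose
    roots are roots of q and so also avoid the spectrum.\<close>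
  have step: "invertible_op (op_poly q T)" 
    if d: "d dvd q" "degree d \<noteq> 0" "invertible_op (op_poly d T)" for d
  proof -
    obtain s where q: "q = d * s" using d(1) by (auto elim: dvdE)
    then have "s \<noteq> 0" "d \<noteq> 0" using less.prems(1) by auto
    then have "invertible_op (op_poly s T)"
      using q d(2) less.prems(2) by (intro less.hyps) (auto simp: degree_mult_eq)
    then show ?thesis using d(3) by (simp add: q op_poly_mult invertible_op_compose)
  qed
  show ?case
  proof (cases "degree q = 0")
    case True
    then obtain c where "q = [:c:]" by (metis degree_0_id)
    then show ?thesis
      using less.prems(1) by (simp add: op_poly_pCons op_poly_0 invertible_op_scaleR invertible_op_id)
  next
    case False
    then show ?thesis
    proof (cases rule: real_poly_factor)
      case (1 t)
      then have "t \<notin> real_spectrum T" using less.prems(2)[of t] by (auto simp: poly_eq_0_iff_dvd)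
      moreover have "op_poly [:- t, 1:] T = T - t *\<^sub>R id_blinfun"
        by (auto intro!: blinfun_eqI simp: op_poly_pCons op_poly_0 blinfun.add_left blinfun.diff_left blinfun.scaleR_left)
      ultimately show ?thesis using 1 by (intro step[of "[:- t, 1:]"]) (auto simp: real_spectrum_iff)
    next
      case (2 a b)
      define R where "R = T - a *\<^sub>R id_blinfun"
      have R: "selfadjoint R" unfolding R_def using T by (intro selfadjoint_intros)
      \<comment> \<open>Completing the square; the quadratic form at x becomes
        \<open>(norm (R x))^2 + b^2 * (norm x)^2\<close>.\<close>
      have eq: "op_poly [:a\<^sup>2 + b\<^sup>2, - 2 * a, 1:] T = (R o\<^sub>L R) + b\<^sup>2 *\<^sub>R id_blinfun"
        by (auto intro!: blinfun_eqI simp: R_def op_poly_pCons op_poly_0 blinfun.bilinear_simps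
            algebra_simps power2_eq_square simp flip: scaleR_2)
      have "inner (R (R x)) x = (norm (R x))\<^sup>2" for x
        using selfadjointD(2)[OF R, of "R x" x] by (simp add: power2_norm_eq_inner)
      then have "invertible_op (op_poly [:a\<^sup>2 + b\<^sup>2, - 2 * a, 1:] T)"
        unfolding eq using selfadjointD(1)[OF R] 2(1)
        by (intro coercive_invertible_op[of _ "b\<^sup>2"] complex_linear_intros)
          (simp_all add: blinfun.add_left blinfun.scaleR_left inner_simps flip: power2_norm_eq_inner)
      with 2 show ?thesis by (intro step) auto
    qed
  qed
qed

lemma op_poly_nonneg:
  fixes T :: "'a::complex_hilbert_space \<Rightarrow>\<^sub>L 'a"
  assumes T: "selfadjoint T" and p: "\<And>t. t \<in> real_spectrum T \<Longrightarrow> 0 \<le> poly p t"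
  shows "0 \<le> inner (op_poly p T x) x"
proof (rule ccontr)
  assume neg: "\<not> 0 \<le> inner (op_poly p T x) x"
  then have x: "x \<noteq> 0" by auto
  obtain l where l: "l \<in> real_spectrum (op_poly p T)" "\<And>x. l * (norm x)\<^sup>2 \<le> inner (op_poly p T x) x"
    using numerical_range_bottom[OF selfadjoint_op_poly[OF T] x] by blast
  \<comment> \<open>A spectral point excludes the case that p is the constant l: there p - l, which
    is l below 0 away from p, must be a nonzero polynomial before it can be factored.\<close>
  obtain t where t: "t \<in> real_spectrum T"
    using numerical_range_bottom[OF T x] by blast
  have "l * (norm x)\<^sup>2 < 0" using l(2)[of x] neg by simp
  then have "l < 0" by (simp add: mult_less_0_iff)
  then have nz: "poly (p - [:l:]) t \<noteq> 0" if "t \<in> real_spectrum T" for t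
    using p[OF that] by simp
  then have "p - [:l:] \<noteq> 0" using t by (metis poly_0)
  from op_poly_invertible[OF T this nz] show False
    using l(1) by (simp add: real_spectrum_iff op_poly_diff op_poly_pCons op_poly_0)
qed

text \<open>Nonnegativity is applied to \<open>\<epsilon>^2 - p^2\<close>; since
  \<open>op_poly p T\<close> is symmetric, the form of its square at x is
  \<open>(norm (op_poly p T x))^2\<close>.\<close>

lemma norm_op_poly_le:
  assumes T: "selfadjoint T" and \<epsilon>: "0 \<le> \<epsilon>" and p: "\<And>t. t \<in> real_spectrum T \<Longrightarrow> \<bar>poly p t\<bar> \<le> \<epsilon>"
  shows "norm (op_poly p T) \<le> \<epsilon>"
proof (rule norm_blinfun_bound[OF \<epsilon>])
  fix x
  have "0 \<le> poly ([:\<epsilon>\<^sup>2:] - p * p) t" if "t \<in> real_spectrum T" for t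
    using power_mono[OF p[OF that], of 2] by (simp add: power2_eq_square)
  from op_poly_nonneg[OF T this]
  have "(norm (op_poly p T x))\<^sup>2 \<le> (\<epsilon> * norm x)\<^sup>2"
    using selfadjointD(2)[OF selfadjoint_op_poly[OF T]]
    by (simp add: op_poly_diff op_poly_mult op_poly_pCons op_poly_0 blinfun.bilinear_simps inner_simps
        power2_norm_eq_inner power_mult_distrib)
  then show "norm (op_poly p T x) \<le> \<epsilon> * norm x"
    by (rule power2_le_imp_le) (simp add: \<epsilon>)
qed

section \<open>Functional calculus\<close>

text \<open>The relation under the definite description in \<open>op_fun\<close>. Calculus rules are
  proved for it directly, and \<open>op_fun_eqI\<close> turns it into an equation.\<close>

definition has_op_fun :: "(real \<Rightarrow> real) \<Rightarrow> ('a::complex_hilbert_space \<Rightarrow>\<^sub>L 'a) \<Rightarrow> ('a \<Rightarrow>\<^sub>L 'a) \<Rightarrow> bool" where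
  "has_op_fun f T S \<longleftrightarrow> (\<exists>p :: nat \<Rightarrow> real poly.
     uniform_limit (real_spectrum T) (\<lambda>n. poly (p n)) f sequentially \<and>
     (\<lambda>n. op_poly (p n) T) \<longlonglongrightarrow> S)"

text \<open>The difference of two approximating sequences tends to 0 uniformly on the spectrum,
  hence in operator norm by \<open>norm_op_poly_le\<close>.\<close>

lemma has_op_fun_unique:
  assumes T: "selfadjoint T" and "has_op_fun f T S" "has_op_fun f T R"
  shows "S = R"
proof -
  obtain p q where p: "uniform_limit (real_spectrum T) (\<lambda>n. poly (p n)) f sequentially"
      "(\<lambda>n. op_poly (p n) T) \<longlonglongrightarrow> S"
    and q: "uniform_limit (real_spectrum T) (\<lambda>n. poly (q n)) f sequentially"
      "(\<lambda>n. op_poly (q n) T) \<longlonglongrightarrow> R"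
    using assms(2,3) unfolding has_op_fun_def by blast
  have ul: "uniform_limit (real_spectrum T) (\<lambda>n. poly (p n - q n)) (\<lambda>t. 0) sequentially"
  proof -
    have "poly (p n - q n) = (\<lambda>t. poly (p n) t - poly (q n) t)" for n by auto
    then show ?thesis using uniform_limit_minus[OF p(1) q(1)] by simp
  qed
  have "(\<lambda>n. op_poly (p n - q n) T) \<longlonglongrightarrow> 0"
  proof (rule tendstoI)
    fix e :: real assume "0 < e"
    then have "\<forall>\<^sub>F n in sequentially. \<forall>t\<in>real_spectrum T. dist (poly (p n - q n) t) 0 < e / 2"
      by (intro uniform_limitD[OF ul]) simp
    then show "\<forall>\<^sub>F n in sequentially. dist (op_poly (p n - q n) T) 0 < e"
    proof (rule eventually_mono)
      fix n assume "\<forall>t\<in>real_spectrum T. dist (poly (p n - q n) t) 0 < e / 2"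
      then have "norm (op_poly (p n - q n) T) \<le> e / 2"
        using \<open>0 < e\<close> by (intro norm_op_poly_le[OF T]) (auto simp: less_imp_le)
      then show "dist (op_poly (p n - q n) T) 0 < e" using \<open>0 < e\<close> by simp
    qed
  qed
  then have "(\<lambda>n. op_poly (p n) T - op_poly (q n) T) \<longlonglongrightarrow> 0" by (simp add: op_poly_diff)
  with tendsto_diff[OF p(2) q(2)] have "S - R = 0" by (rule LIMSEQ_unique)
  then show ?thesis by simp
qed

lemma op_fun_eqI:
  assumes "selfadjoint T" "has_op_fun f T S"
  shows "op_fun f T = S"
proof -
  have "op_fun f T = (THE S. has_op_fun f T S)"
    unfolding op_fun_def has_op_fun_def real_spectrum_def ..
  also have "\<dots> = S"
    using assms(2) by (rule the_equality) (rule has_op_fun_unique[OF assms(1) _ assms(2)])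
  finally show ?thesis .
qed

text \<open>Weierstrass approximation on an interval containing the spectrum supplies the
  polynomials; \<open>norm_op_poly_le\<close> makes their values at T a Cauchy sequence.\<close>

lemma has_op_fun_ex:
  assumes T: "selfadjoint T" and spec: "real_spectrum T \<subseteq> {a..b}" and f: "continuous_on {a..b} f"
  shows "\<exists>S. has_op_fun f T S"
proof -
  have "\<exists>p. \<forall>t\<in>{a..b}. \<bar>f t - poly p t\<bar> < inverse (real (Suc n))" for n
  proof -
    obtain g where g: "real_polynomial_function g" "\<And>t. t \<in> {a..b} \<Longrightarrow> \<bar>f t - g t\<bar> < inverse (real (Suc n))"
      using Stone_Weierstrass_real_polynomial_function[of "{a..b}" f "inverse (real (Suc n))"] f by auto
    obtain c N where "g = (\<lambda>x. \<Sum>i\<le>N. c i * x ^ i)"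
      using real_polynomial_function_imp_sum[OF g(1)] by auto
    then have "poly (\<Sum>i\<le>N. monom (c i) i) = g"
      by (auto simp: poly_sum poly_monom)
    then show ?thesis using g(2) by metis
  qed
  then obtain p where p: "\<And>n t. t \<in> {a..b} \<Longrightarrow> \<bar>f t - poly (p n) t\<bar> < inverse (real (Suc n))"
    by metis
  have ul: "uniform_limit (real_spectrum T) (\<lambda>n. poly (p n)) f sequentially"
  proof (rule uniform_limitI)
    fix e :: real assume "0 < e"
    then have "\<forall>\<^sub>F n in sequentially. inverse (real (Suc n)) < e"
      using LIMSEQ_inverse_real_of_nat by (metis order_tendstoD(2))
    then show "\<forall>\<^sub>F n in sequentially. \<forall>t\<in>real_spectrum T. dist (poly (p n) t) (f t) < e"
    proof (rule eventually_mono)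
      fix n assume n: "inverse (real (Suc n)) < e"
      show "\<forall>t\<in>real_spectrum T. dist (poly (p n) t) (f t) < e"
      proof
        fix t assume "t \<in> real_spectrum T"
        then show "dist (poly (p n) t) (f t) < e"
          using p[of t n] spec n by (auto simp: dist_real_def abs_minus_commute)
      qed
    qed
  qed
  have "Cauchy (\<lambda>n. op_poly (p n) T)"
  proof (rule metric_CauchyI)
    fix e :: real assume e: "0 < e"
    then have "\<forall>\<^sub>F n in sequentially. \<forall>t\<in>real_spectrum T. dist (poly (p n) t) (f t) < e / 3"
      using uniform_limitD[OF ul, of "e / 3"] by simp
    then obtain N where N: "\<And>n t. N \<le> n \<Longrightarrow> t \<in> real_spectrum T \<Longrightarrow> dist (poly (p n) t) (f t) < e / 3"
      unfolding eventually_sequentially by blast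
    have "dist (op_poly (p m) T) (op_poly (p n) T) < e" if "N \<le> m" "N \<le> n" for m n
    proof -
      have "norm (op_poly (p m - p n) T) \<le> 2 * e / 3"
      proof (rule norm_op_poly_le[OF T])
        show "\<bar>poly (p m - p n) t\<bar> \<le> 2 * e / 3" if "t \<in> real_spectrum T" for t
          using N[OF \<open>N \<le> m\<close> that] N[OF \<open>N \<le> n\<close> that] by (simp add: dist_real_def abs_if split: if_splits)
      qed (use e in simp)
      then show ?thesis using e by (simp add: dist_norm op_poly_diff)
    qed
    then show "\<exists>N. \<forall>m\<ge>N. \<forall>n\<ge>N. dist (op_poly (p m) T) (op_poly (p n) T) < e" by blast
  qed
  then show ?thesis
    using ul unfolding has_op_fun_def by (metis Cauchy_convergent_iff convergent_def)
qed

lemma has_op_fun_op_fun: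
  assumes "selfadjoint T" "real_spectrum T \<subseteq> {a..b}" "continuous_on {a..b} f"
  shows "has_op_fun f T (op_fun f T)"
proof -
  obtain S where S: "has_op_fun f T S" using has_op_fun_ex[OF assms] by blast
  then show ?thesis by (simp only: op_fun_eqI[OF assms(1) S])
qed

lemma has_op_fun_cong:
  assumes "has_op_fun f T S" "\<And>t. t \<in> real_spectrum T \<Longrightarrow> f t = g t"
  shows "has_op_fun g T S"
proof -
  have "uniform_limit (real_spectrum T) F f sequentially \<longleftrightarrow> uniform_limit (real_spectrum T) F g sequentially"
    for F :: "nat \<Rightarrow> real \<Rightarrow> real"
    using assms(2) by (intro uniform_limit_cong) auto
  then show ?thesis using assms(1) by (simp add: has_op_fun_def)
qed

section \<open>Algebraic rules of the calculus\<close>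

lemma has_op_fun_poly: "has_op_fun (poly p) T (op_poly p T)"
  unfolding has_op_fun_def by (rule exI[of _ "\<lambda>_. p"]) (auto intro: uniform_limit_const)

lemma has_op_fun_const: "has_op_fun (\<lambda>t. c) T (c *\<^sub>R id_blinfun)"
proof -
  have "op_poly [:c:] T = c *\<^sub>R id_blinfun" by (simp add: op_poly_pCons op_poly_0)
  then have "has_op_fun (poly [:c:]) T (c *\<^sub>R id_blinfun)" using has_op_fun_poly[of "[:c:]" T] by metis
  then show ?thesis by (rule has_op_fun_cong) simp
qed

lemma has_op_fun_ident: "has_op_fun (\<lambda>t. t) T T"
proof -
  have "op_poly [:0, 1:] T = T"
    by (auto intro!: blinfun_eqI simp: op_poly_pCons op_poly_0 blinfun.add_left)
  then have "has_op_fun (poly [:0, 1:]) T T" using has_op_fun_poly[of "[:0, 1:]" T] by metis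
  then show ?thesis by (rule has_op_fun_cong) simp
qed

lemma has_op_fun_add:
  assumes "has_op_fun f T S" "has_op_fun g T R"
  shows "has_op_fun (\<lambda>t. f t + g t) T (S + R)"
proof -
  obtain p q where p: "uniform_limit (real_spectrum T) (\<lambda>n. poly (p n)) f sequentially"
      "(\<lambda>n. op_poly (p n) T) \<longlonglongrightarrow> S"
    and q: "uniform_limit (real_spectrum T) (\<lambda>n. poly (q n)) g sequentially"
      "(\<lambda>n. op_poly (q n) T) \<longlonglongrightarrow> R"
    using assms unfolding has_op_fun_def by blast
  have "poly (p n + q n) = (\<lambda>t. poly (p n) t + poly (q n) t)" for n by auto
  then show ?thesis unfolding has_op_fun_def
    using uniform_limit_add[OF p(1) q(1)] tendsto_add[OF p(2) q(2)]
    by (intro exI[of _ "\<lambda>n. p n + q n"]) (simp add: op_poly_add)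
qed

lemma has_op_fun_mult:
  assumes T: "complex_linear T" and "has_op_fun f T S" "has_op_fun g T R"
  shows "has_op_fun (\<lambda>t. f t * g t) T (S o\<^sub>L R)"
proof -
  obtain p q where p: "uniform_limit (real_spectrum T) (\<lambda>n. poly (p n)) f sequentially"
      "(\<lambda>n. op_poly (p n) T) \<longlonglongrightarrow> S"
    and q: "uniform_limit (real_spectrum T) (\<lambda>n. poly (q n)) g sequentially"
      "(\<lambda>n. op_poly (q n) T) \<longlonglongrightarrow> R"
    using assms unfolding has_op_fun_def by blast
  \<comment> \<open>Products of uniformly convergent sequences converge uniformly when the limits
    are bounded. Polynomials are bounded on a compact interval around the spectrum, and uniform
    limits inherit this.\<close>
  have bdd: "bounded (poly s ` real_spectrum T)" for s
  proof (rule bounded_subset)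
    show "bounded (poly s ` {- norm T..norm T})"
      by (intro compact_imp_bounded compact_continuous_image continuous_intros) auto
    show "poly s ` real_spectrum T \<subseteq> poly s ` {- norm T..norm T}"
      by (rule image_mono[OF real_spectrum_bounded[OF T]])
  qed
  have "bounded (f ` real_spectrum T)" "bounded (g ` real_spectrum T)"
    using bdd by (auto intro: uniform_limit_bounded[OF p(1)] uniform_limit_bounded[OF q(1)])
  moreover have "poly (p n * q n) = (\<lambda>t. poly (p n) t * poly (q n) t)" for n by auto
  ultimately show ?thesis unfolding has_op_fun_def
    using uniform_lim_mult[OF p(1) q(1)]
      bounded_bilinear.tendsto[OF bounded_bilinear_blinfun_compose p(2) q(2)]
    by (intro exI[of _ "\<lambda>n. p n * q n"]) (simp add: op_poly_mult)
qed

lemma has_op_fun_scaleR: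
  assumes "complex_linear T" "has_op_fun f T S"
  shows "has_op_fun (\<lambda>t. c * f t) T (c *\<^sub>R S)"
proof -
  have "(c *\<^sub>R id_blinfun) o\<^sub>L S = c *\<^sub>R S"
    by (auto intro!: blinfun_eqI simp: blinfun.scaleR_left)
  then show ?thesis
    using has_op_fun_mult[OF assms(1) has_op_fun_const assms(2), of c] by simp
qed

lemma has_op_fun_diff:
  assumes "complex_linear T" "has_op_fun f T S" "has_op_fun g T R"
  shows "has_op_fun (\<lambda>t. f t - g t) T (S - R)"
  using has_op_fun_add[OF assms(2) has_op_fun_scaleR[OF assms(1,3), of "-1"]] by simp

lemma selfadjoint_limit:
  fixes S :: "nat \<Rightarrow> 'a::complex_hilbert_space \<Rightarrow>\<^sub>L 'a"
  assumes "\<And>n. selfadjoint (S n)" "S \<longlonglongrightarrow> R"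
  shows "selfadjoint R"
proof -
  have lim: "(\<lambda>n. S n x) \<longlonglongrightarrow> R x" for x
    by (intro blinfun.tendsto assms(2) tendsto_const)
  have "R (c *\<^sub>C x) = c *\<^sub>C R x" for c x
  proof (rule LIMSEQ_unique[OF lim])
    show "(\<lambda>n. S n (c *\<^sub>C x)) \<longlonglongrightarrow> c *\<^sub>C R x"
      using tendsto_scaleC[OF lim, of c x] selfadjointD(1)[OF assms(1)] by (simp add: complex_linear_def)
  qed
  moreover have "inner (R x) y = inner x (R y)" for x y
  proof (rule LIMSEQ_unique)
    show "(\<lambda>n. inner (S n x) y) \<longlonglongrightarrow> inner (R x) y"
      by (intro tendsto_inner lim tendsto_const)
    show "(\<lambda>n. inner (S n x) y) \<longlonglongrightarrow> inner x (R y)"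
      unfolding selfadjointD(2)[OF assms(1)] by (intro tendsto_inner lim tendsto_const)
  qed
  ultimately show ?thesis by (simp add: selfadjoint_def complex_linear_def)
qed

lemma has_op_fun_selfadjoint:
  assumes "selfadjoint T" "has_op_fun f T S"
  shows "selfadjoint S"
proof -
  obtain p where "(\<lambda>n. op_poly (p n) T) \<longlonglongrightarrow> S"
    using assms(2) by (auto simp: has_op_fun_def)
  then show ?thesis by (rule selfadjoint_limit[OF selfadjoint_op_poly[OF assms(1)]])
qed

text \<open>For any e > 0, late approximants shifted up by e are nonnegative on the spectrum, so
  \<open>op_poly_nonneg\<close> bounds their forms below by \<open>- (e * (norm x)^2)\<close>. The
  limit in n and then e tending to 0 give the claim.\<close>

lemma has_op_fun_positive:
  assumes T: "selfadjoint T" and f: "has_op_fun f T S" and pos: "\<And>t. t \<in> real_spectrum T \<Longrightarrow> 0 \<le> f t"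
  shows "positive_op S"
  unfolding positive_op_iff
proof (intro conjI allI)
  show "selfadjoint S" by (rule has_op_fun_selfadjoint[OF T f])
  fix x
  obtain p where p: "uniform_limit (real_spectrum T) (\<lambda>n. poly (p n)) f sequentially"
      "(\<lambda>n. op_poly (p n) T) \<longlonglongrightarrow> S"
    using f by (auto simp: has_op_fun_def)
  have lim: "(\<lambda>n. inner (op_poly (p n) T x) x) \<longlonglongrightarrow> inner (S x) x"
    by (intro tendsto_inner blinfun.tendsto p(2) tendsto_const)
  have "- (e * (norm x)\<^sup>2) \<le> inner (S x) x" if "0 < e" for e
  proof (rule tendsto_lowerbound[OF lim])
    have "\<forall>\<^sub>F n in sequentially. \<forall>t\<in>real_spectrum T. dist (poly (p n) t) (f t) < e"
      using uniform_limitD[OF p(1) that] .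
    then show "\<forall>\<^sub>F n in sequentially. - (e * (norm x)\<^sup>2) \<le> inner (op_poly (p n) T x) x"
    proof (rule eventually_mono)
      fix n assume n: "\<forall>t\<in>real_spectrum T. dist (poly (p n) t) (f t) < e"
      have "0 \<le> poly (p n + [:e:]) t" if "t \<in> real_spectrum T" for t
      proof -
        have "\<bar>poly (p n) t - f t\<bar> < e" using n that by (auto simp: dist_real_def)
        then show ?thesis using pos[OF that] by simp
      qed
      from op_poly_nonneg[OF T this, of x] show "- (e * (norm x)\<^sup>2) \<le> inner (op_poly (p n) T x) x"
        by (simp add: op_poly_add op_poly_pCons op_poly_0 blinfun.bilinear_simps inner_simps power2_norm_eq_inner)
    qed
  qed simp
  then have "0 \<le> inner (S x) x + e" if "0 < e" for e
  proof (cases "x = 0")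
    case False
    then show ?thesis
      using \<open>\<And>e. 0 < e \<Longrightarrow> - (e * (norm x)\<^sup>2) \<le> inner (S x) x\<close>[of "e / (norm x)\<^sup>2"] that by simp
  qed (use that in simp)
  then show "0 \<le> inner (S x) x" by (rule field_le_epsilon)
qed

text \<open>The constant a keeps the spectrum in an interval away from 0, on which powers with any
  real exponent are continuous.\<close>

lemma has_op_fun_powr:
  assumes T: "selfadjoint T" and "0 < a" and lo: "\<And>x. a * (norm x)\<^sup>2 \<le> inner (T x) x"
  shows "has_op_fun (\<lambda>t. t powr s) T (op_powr T s)"
  unfolding op_powr_def
proof (rule has_op_fun_op_fun[OF T])
  show "real_spectrum T \<subseteq> {a..norm T}"
    using real_spectrum_lower[OF selfadjointD(1)[OF T] lo] real_spectrum_bounded[OF selfadjointD(1)[OF T]]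
    by fastforce
  show "continuous_on {a..norm T} (\<lambda>t. t powr s)"
    using \<open>0 < a\<close> by (intro continuous_intros) auto
qed

text \<open>The result S is left relational because exponent sums 1 and 0 should give T and the
  identity rather than further powers.\<close>

lemma op_powr_compose:
  assumes T: "selfadjoint T" and a: "0 < a" "\<And>x. a * (norm x)\<^sup>2 \<le> inner (T x) x"
    and f: "has_op_fun (\<lambda>t. t powr (s + u)) T S"
  shows "op_powr T s o\<^sub>L op_powr T u = S"
proof (rule has_op_fun_unique[OF T _ f])
  have "has_op_fun (\<lambda>t. t powr s * t powr u) T (op_powr T s o\<^sub>L op_powr T u)"
    by (intro has_op_fun_mult has_op_fun_powr[OF T a] selfadjointD(1)[OF T])
  then show "has_op_fun (\<lambda>t. t powr (s + u)) T (op_powr T s o\<^sub>L op_powr T u)"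
    by (simp add: powr_add)
qed

lemma op_powr_half_compose:
  assumes T: "selfadjoint T" and a: "0 < a" "\<And>x. a * (norm x)\<^sup>2 \<le> inner (T x) x"
  shows "op_powr T (1/2) o\<^sub>L op_powr T (1/2) = T"
    and "op_powr T (1/2) o\<^sub>L op_powr T (- 1/2) = id_blinfun"
    and "op_powr T (- 1/2) o\<^sub>L op_powr T (1/2) = id_blinfun"
proof -
  \<comment> \<open>Needed since \<open>t powr 1\<close> is t only for nonnegative t, and
    \<open>0 powr 0\<close> is 0.\<close>
  have pos: "0 < t" if "t \<in> real_spectrum T" for t
    using real_spectrum_lower[OF selfadjointD(1)[OF T] a(2) that] a(1) by simp
  have "has_op_fun (\<lambda>t. t powr (1/2 + 1/2)) T T"
    by (rule has_op_fun_cong[OF has_op_fun_ident]) (use pos in force)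
  then show "op_powr T (1/2) o\<^sub>L op_powr T (1/2) = T"
    by (rule op_powr_compose[OF T a])
  have "has_op_fun (\<lambda>t. t powr 0) T (1 *\<^sub>R id_blinfun)"
    by (rule has_op_fun_cong[OF has_op_fun_const]) (use pos in force)
  then show "op_powr T (1/2) o\<^sub>L op_powr T (- 1/2) = id_blinfun"
    "op_powr T (- 1/2) o\<^sub>L op_powr T (1/2) = id_blinfun"
    by (auto intro!: op_powr_compose[OF T a])
qed

section \<open>Operator means\<close>

lemma positive_op_compose_compose:
  assumes "selfadjoint S" "positive_op T"
  shows "positive_op (S o\<^sub>L T o\<^sub>L S)"
  using assms(2) selfadjoint_compose_compose[OF assms(1)]
  by (auto simp: positive_op_iff selfadjointD(2)[OF assms(1)])

theorem corollary3p1: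
  fixes A B :: "'a::complex_hilbert_space \<Rightarrow>\<^sub>L 'a"
    and m m' M M' v h r r1 r1' :: real
  assumes "separable_space (euclidean :: 'a topology)"
    and "positive_op A" and "invertible_op A"
    and "positive_op B" and "invertible_op B"
    and "0 < m" and "0 < m'" and "0 < M" and "0 < M'"
    and "(m' *\<^sub>R id_blinfun \<preceq> A \<and> A \<preceq> m *\<^sub>R id_blinfun \<and> m < M \<and>
          M *\<^sub>R id_blinfun \<preceq> B \<and> B \<preceq> M' *\<^sub>R id_blinfun) \<or>
         (m' *\<^sub>R id_blinfun \<preceq> B \<and> B \<preceq> m *\<^sub>R id_blinfun \<and> m < M \<and>
          M *\<^sub>R id_blinfun \<preceq> A \<and> A \<preceq> M' *\<^sub>R id_blinfun)"
    and "0 < v" and "v < 1"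
    and "h = M / m"
    and "r = min v (1 - v)"
    and "r1 = min (2 * r) (1 - 2 * r)"
    and "r1' = min (2 * r1) (1 - 2 * r1)"
  shows "(2 * r) *\<^sub>R (arith_mean (1/2) A B - geom_mean (1/2) A B)
         + r1 *\<^sub>R (arith_mean (1/2) A B + geom_mean (1/2) A B - 2 *\<^sub>R heinz_mean (1/4) A B)
         + (kantorovich (root 4 h) powr r1') *\<^sub>R heinz_mean v A B
         \<preceq> arith_mean (1/2) A B"
proof -
  have A: "selfadjoint A" and B: "selfadjoint B"
    using assms(2,4) by (simp_all add: positive_op_iff)
  have le_iff: "c *\<^sub>R id_blinfun \<preceq> T \<longleftrightarrow> (\<forall>x. c * (norm x)\<^sup>2 \<le> inner (T x) x)"
    "T \<preceq> c *\<^sub>R id_blinfun \<longleftrightarrow> (\<forall>x. inner (T x) x \<le> c * (norm x)\<^sup>2)"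
    if "selfadjoint T" for c and T :: "'a \<Rightarrow>\<^sub>L 'a"
    by (simp_all add: loewner_le_iff[OF _ that] loewner_le_iff[OF that] selfadjoint_intros
        blinfun.scaleR_left inner_simps power2_norm_eq_inner)
  obtain a where a: "0 < a" "\<And>x. a * (norm x)\<^sup>2 \<le> inner (A x) x"
    using positive_invertible_coercive[OF assms(2,3)] by blast
  define X where "X = op_powr A (1/2)"
  define Y where "Y = op_powr A (- 1/2)"
  define C where "C = Y o\<^sub>L B o\<^sub>L Y"
  have X: "selfadjoint X" and Y: "selfadjoint Y"
    unfolding X_def Y_def by (rule has_op_fun_selfadjoint[OF A has_op_fun_powr[OF A a]])+
  have XX: "X (X x) = A x" and XY: "X (Y x) = x" and YX: "Y (X x) = x" for x
    using op_powr_half_compose[OF A a, folded X_def Y_def]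
    by (metis blinfun_apply_blinfun_compose blinfun_apply_id_blinfun id_apply)+
  have C: "selfadjoint C" unfolding C_def by (rule selfadjoint_compose_compose[OF Y B])
  have inner_C: "inner (C x) x = inner (B (Y x)) (Y x)" for x
    by (simp add: C_def selfadjointD(2)[OF Y])
  \<comment> \<open>Y normalises A to the identity, so an inequality between the forms of A and B,
    read at \<open>Y x\<close>, bounds the form of C by a scalar.\<close>
  have inner_A: "inner (A (Y x)) (Y x) = (norm x)\<^sup>2" for x
    by (simp add: XX[symmetric] XY selfadjointD(2)[OF X] power2_norm_eq_inner)
  have h: "1 < h" using assms by auto
  obtain l where l: "0 < l" "\<And>x. l * (norm x)\<^sup>2 \<le> inner (C x) x"
    and spec: "\<And>t. t \<in> real_spectrum C \<Longrightarrow> h \<le> t \<or> h * t \<le> 1"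
    using assms(10)
  proof
    assume *: "m' *\<^sub>R id_blinfun \<preceq> A \<and> A \<preceq> m *\<^sub>R id_blinfun \<and> m < M \<and>
          M *\<^sub>R id_blinfun \<preceq> B \<and> B \<preceq> M' *\<^sub>R id_blinfun"
    \<comment> \<open>Because \<open>h * m = M\<close>, the form of \<open>h *\<^sub>R A\<close>
      lies below M and that of B above it; hence h is a lower bound for C.\<close>
    have "h * inner (A x) x \<le> inner (B x) x" for x
    proof -
      have "inner (A x) x \<le> m * (norm x)\<^sup>2" "M * (norm x)\<^sup>2 \<le> inner (B x) x"
        using * by (simp_all add: le_iff[OF A] le_iff[OF B])
      moreover from this(1) have "h * inner (A x) x \<le> h * (m * (norm x)\<^sup>2)"
        using h by (intro mult_left_mono) auto
      ultimately show ?thesis using assms(6,13) by simp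
    qed
    then have "h * (norm x)\<^sup>2 \<le> inner (C x) x" for x by (metis inner_A inner_C)
    then show ?thesis
      using that[of h] h real_spectrum_lower[OF selfadjointD(1)[OF C]] by auto
  next
    assume *: "m' *\<^sub>R id_blinfun \<preceq> B \<and> B \<preceq> m *\<^sub>R id_blinfun \<and> m < M \<and>
          M *\<^sub>R id_blinfun \<preceq> A \<and> A \<preceq> M' *\<^sub>R id_blinfun"
    have "inner (B x) x \<le> inverse h * inner (A x) x" for x
    proof -
      have "inner (B x) x \<le> m * (norm x)\<^sup>2" "M * (norm x)\<^sup>2 \<le> inner (A x) x"
        using * by (simp_all add: le_iff[OF A] le_iff[OF B])
      moreover from this(2) have "inverse h * (M * (norm x)\<^sup>2) \<le> inverse h * inner (A x) x"
        using h by (intro mult_left_mono) auto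
      ultimately show ?thesis using assms(8,13) by simp
    qed
    then have "inner (C x) x \<le> inverse h * (norm x)\<^sup>2" for x by (metis inner_A inner_C)
    then have "t \<le> inverse h" if "t \<in> real_spectrum C" for t
      using real_spectrum_upper[OF selfadjointD(1)[OF C]] that by blast
    then have "h * t \<le> 1" if "t \<in> real_spectrum C" for t
      using that h by (force simp: field_simps)
    \<comment> \<open>The upper bound \<open>inverse h\<close> does not keep C away from 0; the
      outer constants provide the positive lower bound that the powers of C require.\<close>
    moreover have "m' / M' * inner (A x) x \<le> inner (B x) x" for x
    proof -
      have "inner (A x) x \<le> M' * (norm x)\<^sup>2" "m' * (norm x)\<^sup>2 \<le> inner (B x) x"
        using * by (simp_all add: le_iff[OF A] le_iff[OF B])
      moreover from this(1) have "m' / M' * inner (A x) x \<le> m' / M' * (M' * (norm x)\<^sup>2)"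
        using assms(7,9) by (intro mult_left_mono) auto
      ultimately show ?thesis using assms(9) by simp
    qed
    then have "m' / M' * (norm x)\<^sup>2 \<le> inner (C x) x" for x by (metis inner_A inner_C)
    ultimately show ?thesis
      using that[of "m' / M'"] assms(7,9) by simp
  qed
  define K where "K = kantorovich (root 4 h) powr r1'"
  define E where "E = (1/2) *\<^sub>R id_blinfun + (1/2) *\<^sub>R C"
  \<comment> \<open>D is the right side minus the left side with A replaced by the identity and B by
    C. The powers 1/4 and 3/4 are twice the Heinz mean at 1/4.\<close>
  define D where "D = E - ((2 * r) *\<^sub>R (E - op_powr C (1/2))
    + r1 *\<^sub>R (E + op_powr C (1/2) - (op_powr C (1/4) + op_powr C (3/4)))
    + K *\<^sub>R ((1/2) *\<^sub>R (op_powr C v + op_powr C (1 - v))))"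
  define e :: "real \<Rightarrow> real" where "e t = 1/2 + 1/2 * t" for t
  have D: "has_op_fun (\<lambda>t. e t - ((2 * r) * (e t - t powr (1/2))
    + r1 * (e t + t powr (1/2) - (t powr (1/4) + t powr (3/4)))
    + K * ((1/2) * (t powr v + t powr (1 - v))))) C D"
    unfolding D_def E_def e_def
    by (intro has_op_fun_add has_op_fun_diff has_op_fun_scaleR has_op_fun_const has_op_fun_ident
        has_op_fun_powr[OF C l] selfadjointD(1)[OF C])
  have "positive_op D"
  proof (rule has_op_fun_positive[OF C D])
    fix t assume t: "t \<in> real_spectrum C"
    have "0 < t" using real_spectrum_lower[OF selfadjointD(1)[OF C] l(2) t] l(1) by simp
    from heinz_scalar[OF _ _ this h spec[OF t] assms(14-16)] assms(11,12)
    show "0 \<le> e t - ((2 * r) * (e t - t powr (1/2))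
      + r1 * (e t + t powr (1/2) - (t powr (1/4) + t powr (3/4)))
      + K * ((1/2) * (t powr v + t powr (1 - v))))"
      by (simp add: e_def K_def add_divide_distrib)
  qed
  then have "positive_op (X o\<^sub>L D o\<^sub>L X)"
    by (rule positive_op_compose_compose[OF X])
  \<comment> \<open>Conjugation by X is linear, sends the identity to A and C to B, and turns each
    power of C into the corresponding geometric mean.\<close>
  also have "X o\<^sub>L D o\<^sub>L X = arith_mean (1/2) A B
    - ((2 * r) *\<^sub>R (arith_mean (1/2) A B - geom_mean (1/2) A B)
      + r1 *\<^sub>R (arith_mean (1/2) A B + geom_mean (1/2) A B - 2 *\<^sub>R heinz_mean (1/4) A B)
      + K *\<^sub>R heinz_mean v A B)"
  proof -
    have geom: "geom_mean s A B = X o\<^sub>L op_powr C s o\<^sub>L X" for s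
      by (simp add: geom_mean_def X_def C_def Y_def)
    have "X (C (X x)) = B x" for x by (simp add: C_def XY YX)
    then have "X (E (X x)) = arith_mean (1/2) A B x" for x
      by (simp add: E_def arith_mean_def blinfun.bilinear_simps XX)
    then show ?thesis
      by (intro blinfun_eqI) (simp add: D_def heinz_mean_def geom blinfun.bilinear_simps)
  qed
  finally show ?thesis by (simp add: loewner_le_def K_def)
qed

end
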